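(* Let $G$ and $H$ be two finite groups, written additively, with $|G|=2^n$ and $|H|=4$, and let $F\colon G\to H$ be a perfect nonlinear function. Then there are only two possible preimage distributions for $F$, namely the two extremal ones: either for some $\alpha\in H$, $|F^{-1}(\alpha)|=\frac{|G|}{|H|}-\sqrt{|G|}+\frac{\sqrt{|G|}}{|H|}$ and $|F^{-1}(\beta)|=\frac{|G|}{|H|}+\frac{\sqrt{|G|}}{|H|}$ for each $\beta\neq\alpha$; or for some $\alpha\in H$, $|F^{-1}(\alpha)|=\frac{|G|}{|H|}+\sqrt{|G|}-\frac{\sqrt{|G|}}{|H|}$ and $|F^{-1}(\beta)|=\frac{|G|}{|H|}-\frac{\sqrt{|G|}}{|H|}$ for each $\beta\neq\alpha$.
   Context: A function $F\colon G\to H$ between finite groups (written additively, not necessarily abelian) is perfect nonlinear if $|\{x\in G: F(x+a)-F(x)=b\}|=|G|/|H|$ for all $a\in G\setminus\{0\}$ and all $b\in H$. The preimage distribution of $F$ is the multiset of the sizes $|F^{-1}(\beta)|$, $\beta\in H$. *)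

theory Defs
  imports Complex_Main "HOL-Library.Cardinality"
begin

text \<open>
  Finite groups, written additively and not necessarily abelian, are types of sort
  \<open>{group_add, finite}\<close>: the class \<open>group_add\<close> does not assume commutativity of \<open>+\<close>,
  and \<open>x - y\<close> is \<open>x + (- y)\<close>. The equation is stated over the reals, so
  \<open>|G|/|H|\<close> is an exact quotient, not a truncated one.
\<close>

definition perfect_nonlinear :: "('g::{group_add,finite} \<Rightarrow> 'h::{group_add,finite}) \<Rightarrow> bool"
  where "perfect_nonlinear F \<longleftrightarrow>
    (\<forall>a b. a \<noteq> 0 \<longrightarrow> real (card {x. F (x + a) - F x = b}) = real CARD('g) / real CARD('h))"

end

theory Submission imports Defs "HOL-Computational_Algebra.Primes" begin

text \<open>
  Let \<open>N = |G|\<close> and let \<open>k \<beta>\<close> be the size of the fibre over \<open>\<beta>\<close>. Counting the pairs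
  \<open>(x, y)\<close> with \<open>F y - F x = b\<close> determines all autocorrelations \<open>\<Sum>\<beta>. k \<beta> * k (b + \<beta>)\<close>.
  If \<open>t\<close> is an involution of \<open>H\<close> and \<open>u\<close>, \<open>t + u\<close> are the other two elements, those at
  \<open>b = 0\<close> and \<open>b = t\<close> give \<open>(k 0 + k t - k u - k (t + u))\<^sup>2 = N\<close>, so \<open>N = 4 ^ m\<close>. The one at
  \<open>b = 0\<close> says that the squares of the three balanced signed sums of the \<open>k \<beta>\<close> add up to
  \<open>3 * 4 ^ m\<close>. By descent modulo 4, all three are \<open>2 ^ m\<close> or \<open>- 2 ^ m\<close>, and the eight
  choices of signs are the claimed distributions.
\<close>

text \<open>A square is 0 or 1 modulo 4, so three squares sum to 0 modulo 4 only if none of them is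
  odd.\<close>

lemma even_if_four_dvd_sum_three_squares:
  fixes x y z :: int
  assumes "4 dvd x\<^sup>2 + y\<^sup>2 + z\<^sup>2"
  shows "even x" "even y" "even z"
proof -
  have sq: "w\<^sup>2 mod 4 = (if even w then 0 else 1)" for w :: int
  proof (cases "even w")
    case True
    then show ?thesis by (auto elim!: evenE)
  next
    case False
    then obtain j where "w = 2 * j + 1" by (elim oddE)
    then have "w\<^sup>2 = 1 + 4 * (j\<^sup>2 + j)" by (simp add: power2_eq_square algebra_simps)
    then show ?thesis using False by simp presburger
  qed
  have "((x\<^sup>2 mod 4) + (y\<^sup>2 mod 4) + (z\<^sup>2 mod 4)) mod 4 = 0"
    using assms by (metis mod_add_eq mod_add_left_eq dvd_eq_mod_eq_0)
  then have "even x \<and> even y \<and> even z"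
    unfolding sq by (cases "even x"; cases "even y"; cases "even z"; simp)
  then show "even x" "even y" "even z" by simp_all
qed

text \<open>While \<open>m\<close> is positive, all three numbers are even and halving them lowers
  \<open>m\<close> by one. At \<open>m = 0\<close> the sum is 3, which only 1 + 1 + 1
  achieves.\<close>

lemma sum_three_squares_eq_three_times_power4:
  fixes x y z :: int
  assumes "x\<^sup>2 + y\<^sup>2 + z\<^sup>2 = 3 * 4 ^ m"
  shows "\<bar>x\<bar> = 2 ^ m \<and> \<bar>y\<bar> = 2 ^ m \<and> \<bar>z\<bar> = 2 ^ m"
  using assms
proof (induction m arbitrary: x y z)
  case 0
  have le: "w\<^sup>2 \<le> 1" if "w\<^sup>2 \<le> 3" for w :: int
  proof -
    have "\<bar>w\<bar>\<^sup>2 < 2\<^sup>2" using that by simp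
    then have "\<bar>w\<bar> < 2" by (rule power2_less_imp_less) simp
    then show ?thesis by (simp add: abs_square_le_1)
  qed
  have "x\<^sup>2 \<le> 3" "y\<^sup>2 \<le> 3" "z\<^sup>2 \<le> 3"
    using 0 zero_le_power2[of x] zero_le_power2[of y] zero_le_power2[of z]
    unfolding power_0 by linarith+
  then have "x\<^sup>2 \<le> 1" "y\<^sup>2 \<le> 1" "z\<^sup>2 \<le> 1" by (auto intro: le)
  with 0 have "x\<^sup>2 = 1" "y\<^sup>2 = 1" "z\<^sup>2 = 1" by auto
  then show ?case by (simp add: abs_square_eq_1)
next
  case (Suc m)
  have "4 dvd x\<^sup>2 + y\<^sup>2 + z\<^sup>2" unfolding Suc.prems by simp
  from even_if_four_dvd_sum_three_squares[OF this]
  obtain a b c where "x = 2 * a" "y = 2 * b" "z = 2 * c"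
    by (auto elim!: evenE)
  moreover from this Suc.prems have "a\<^sup>2 + b\<^sup>2 + c\<^sup>2 = 3 * 4 ^ m"
    by (simp add: power_mult_distrib)
  ultimately show ?case
    using Suc.IH[of a b c] by (simp add: abs_mult)
qed

lemma even_exponent_if_power2_square:
  fixes c :: int
  assumes "c\<^sup>2 = 2 ^ n"
  shows "even n"
proof -
  have "c \<noteq> 0" using assms by auto
  then have "multiplicity 2 (c\<^sup>2) = 2 * multiplicity 2 c"
    by (intro prime_elem_multiplicity_power_distrib) auto
  then show ?thesis
    unfolding assms by (simp add: multiplicity_same_power)
qed

text \<open>The two cosets of \<open>{0, t}\<close> for an involution \<open>t\<close> exhaust the
  group. This treats the cyclic group and the Klein group together, as nothing is claimed about
  \<open>u + u\<close>.\<close>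

lemma group_card_4_cases:
  assumes "CARD('h::{group_add,finite}) = 4"
  obtains t u :: "'h::{group_add,finite}" where "UNIV = {0, t, u, t + u}" "distinct [0, t, u, t + u]" "t + t = 0"
proof -
  have *: "\<exists>w. w \<notin> S" if "card S < 4" for S :: "'h set"
    using that assms by (metis UNIV_eq_I less_irrefl)
  obtain t :: 'h where t: "t \<noteq> 0" "t + t = 0"
  proof -
    obtain x :: 'h where x: "x \<noteq> 0" using *[of "{0}"] by auto
    show thesis
    proof (cases "x + x = 0")
      case True
      with x that show ?thesis by blast
    next
      case False
      \<comment> \<open>Negation fixes 0 and swaps \<open>x\<close> with \<open>- x\<close>, so it
        must also fix the one remaining element \<open>w\<close>.\<close>
      have "card {0, x, - x} < 4" by (simp add: card_insert_if)
      from *[OF this] obtain w where w: "w \<notin> {0, x, - x}" by blast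
      have "- x \<noteq> x" using False by (metis right_minus)
      then have c: "card {0, x, - x, w} = 4" using x w by (auto simp: card_insert_if)
      then have "UNIV = {0, x, - x, w}"
        using assms by (metis card_subset_eq finite_class.finite_UNIV subset_UNIV)
      then have "- w \<in> {0, x, - x, w}" by blast
      then have "- w = w" using w by (metis insertE insertCI singletonD minus_minus minus_zero)
      then have "w + w = 0" by (metis right_minus)
      with w that show ?thesis by blast
    qed
  qed
  have "card {0, t} < 4" by (simp add: card_insert_if)
  from *[OF this] obtain u where u: "u \<notin> {0, t}" by blast
  have "t + u \<noteq> 0" "t + u \<noteq> t" "t + u \<noteq> u" 
    using u t by (metis add_left_cancel add_right_cancel add_0 add_0_right insertCI)+
  then have d: "distinct [0, t, u, t + u]" using u t by (auto dest: sym)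
  then have "card (set [0, t, u, t + u]) = 4" by (subst distinct_card) simp_all
  then have "UNIV = set [0, t, u, t + u]"
    using assms by (metis card_subset_eq finite_class.finite_UNIV subset_UNIV)
  then show thesis using that d t by auto
qed

lemma sum_card_fibres:
  fixes F :: "'g::finite \<Rightarrow> 'h::finite"
  shows "(\<Sum>\<beta>\<in>UNIV. card (F -` {\<beta>})) = CARD('g)"
proof -
  have "(\<Sum>\<beta>\<in>UNIV. card (F -` {\<beta>})) = card (\<Union>\<beta>\<in>UNIV. F -` {\<beta>})"
    by (intro card_UN_disjoint[symmetric]) auto
  also have "(\<Union>\<beta>\<in>UNIV. F -` {\<beta>}) = UNIV" by auto
  finally show ?thesis .
qed

text \<open>Both sides count the pairs \<open>(x, y)\<close> with \<open>F y = b + F x\<close>: on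
  the left by the value \<open>\<beta>\<close> of \<open>F x\<close>, on the right by the shift
  \<open>a\<close> with \<open>y = x + a\<close>.\<close>

lemma fibre_autocorrelation:
  fixes F :: "'g::{group_add,finite} \<Rightarrow> 'h::{group_add,finite}"
  shows "(\<Sum>\<beta>\<in>UNIV. card (F -` {\<beta>}) * card (F -` {b + \<beta>})) =
    (\<Sum>a\<in>UNIV. card {x. F (x + a) - F x = b})"
proof -
  have "(\<Sum>a\<in>UNIV. card {x. F (x + a) - F x = b}) =
      card (SIGMA a:UNIV. {x. F (x + a) - F x = b})"
    by simp
  also have "\<dots> = card (\<Union>\<beta>\<in>UNIV. F -` {\<beta>} \<times> F -` {b + \<beta>})"
    by (intro bij_betw_same_card[of "\<lambda>(a, x). (x, x + a)"]
          bij_betw_byWitness[where f' = "\<lambda>(x, y). (- x + y, x)"])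
      (auto simp: diff_eq_eq add.assoc[symmetric])
  also have "\<dots> = (\<Sum>\<beta>\<in>UNIV. card (F -` {\<beta>} \<times> F -` {b + \<beta>}))"
    by (intro card_UN_disjoint) auto
  finally show ?thesis by (simp add: card_cartesian_product)
qed

lemma perfect_nonlinear_autocorrelation:
  fixes F :: "'g::{group_add,finite} \<Rightarrow> 'h::{group_add,finite}"
  assumes "perfect_nonlinear F"
  defines "N \<equiv> real CARD('g)"
  shows "(\<Sum>\<beta>\<in>UNIV. real (card (F -` {\<beta>})) * real (card (F -` {b + \<beta>}))) =
    (if b = 0 then N else 0) + (N - 1) * (N / real CARD('h))"
proof -
  have "(\<Sum>\<beta>\<in>UNIV. real (card (F -` {\<beta>})) * real (card (F -` {b + \<beta>}))) =
      (\<Sum>a\<in>UNIV. real (card {x. F (x + a) - F x = b}))"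
    using arg_cong[OF fibre_autocorrelation[of F b], of real] by simp
  \<comment> \<open>Perfect nonlinearity says nothing about the zero shift, which contributes
    everything for \<open>b = 0\<close> and nothing otherwise.\<close>
  also have "\<dots> = real (card {x. F (x + 0) - F x = b}) +
      (\<Sum>a\<in>UNIV - {0}. real (card {x. F (x + a) - F x = b}))"
    by (intro sum.remove) auto
  also have "(\<Sum>a\<in>UNIV - {0}. real (card {x. F (x + a) - F x = b})) =
      (\<Sum>a\<in>UNIV - {0 :: 'g}. N / real CARD('h))"
    using assms by (intro sum.cong) (auto simp: perfect_nonlinear_def)
  also have "\<dots> = (N - 1) * (N / real CARD('h))"
    by (simp add: N_def card_Diff_singleton of_nat_diff Suc_le_eq)
  also have "real (card {x. F (x + 0) - F x = b}) = (if b = 0 then N else 0)"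
    by (auto simp: N_def)
  finally show ?thesis .
qed

theorem theorem5p10:
  fixes F :: "'g::{group_add,finite} \<Rightarrow> 'h::{group_add,finite}"
    and n :: nat
  assumes "CARD('g) = 2 ^ n"
    and "CARD('h) = 4"
    and "perfect_nonlinear F"
  shows "(\<exists>\<alpha>.
      real (card (F -` {\<alpha>})) =
        real CARD('g) / real CARD('h) - sqrt (real CARD('g)) + sqrt (real CARD('g)) / real CARD('h) \<and>
      (\<forall>\<beta>. \<beta> \<noteq> \<alpha> \<longrightarrow> real (card (F -` {\<beta>})) =
        real CARD('g) / real CARD('h) + sqrt (real CARD('g)) / real CARD('h)))
    \<or> (\<exists>\<alpha>.
      real (card (F -` {\<alpha>})) =
        real CARD('g) / real CARD('h) + sqrt (real CARD('g)) - sqrt (real CARD('g)) / real CARD('h) \<and>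
      (\<forall>\<beta>. \<beta> \<noteq> \<alpha> \<longrightarrow> real (card (F -` {\<beta>})) =
        real CARD('g) / real CARD('h) - sqrt (real CARD('g)) / real CARD('h)))"
proof -
  obtain t u :: 'h where H: "UNIV = {0, t, u, t + u}" and d: "distinct [0, t, u, t + u]"
    and tt: "t + t = 0"
    using group_card_4_cases[OF assms(2)] .
  define N where "N = real CARD('g)"
  define k where "k \<beta> = int (card (F -` {\<beta>}))" for \<beta>
  have sumH: "(\<Sum>\<beta>\<in>UNIV. f \<beta>) = f 0 + f t + f u + f (t + u)" for f :: "'h \<Rightarrow> real"
    unfolding H using d by (simp add: add.assoc)
  have "(\<Sum>\<beta>\<in>UNIV. real (card (F -` {\<beta>}))) = N"
    unfolding N_def by (metis sum_card_fibres of_nat_sum)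
  then have s1: "real_of_int (k 0 + k t + k u + k (t + u)) = N"
    unfolding sumH by (simp add: k_def)
  \<comment> \<open>Left translation by \<open>t\<close> swaps 0 with \<open>t\<close> and
    \<open>u\<close> with \<open>t + u\<close>, so each product occurs twice in the autocorrelation
    at \<open>t\<close>.\<close>
  have "t + (t + u) = u" using tt by (metis add.assoc add_0)
  with perfect_nonlinear_autocorrelation[OF assms(3), of t] d tt
  have st: "real_of_int (2 * k 0 * k t + 2 * k u * k (t + u)) = (N - 1) * (N / 4)"
    unfolding sumH N_def[symmetric] by (simp add: k_def assms(2) algebra_simps)
  from perfect_nonlinear_autocorrelation[OF assms(3), of 0]
  have s0: "real_of_int ((k 0)\<^sup>2 + (k t)\<^sup>2 + (k u)\<^sup>2 + (k (t + u))\<^sup>2) = N + (N - 1) * (N / 4)"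
    unfolding sumH N_def[symmetric] by (simp add: k_def assms(2) power2_eq_square)
  define c1 c2 c3 where c1: "c1 = k 0 + k t - k u - k (t + u)"
    and c2: "c2 = k 0 - k t + k u - k (t + u)"
    and c3: "c3 = k 0 - k t - k u + k (t + u)"
  \<comment> \<open>This is \<open>(A - B)\<^sup>2 = 2 * (A\<^sup>2 + B\<^sup>2) - (A +
    B)\<^sup>2\<close> for \<open>A = k 0 + k t\<close> and
    \<open>B = k u + k (t + u)\<close>.\<close>
  have "real_of_int (c1\<^sup>2) = 2 * (real_of_int ((k 0)\<^sup>2 + (k t)\<^sup>2 + (k u)\<^sup>2 + (k (t + u))\<^sup>2)
      + real_of_int (2 * k 0 * k t + 2 * k u * k (t + u)))
      - (real_of_int (k 0 + k t + k u + k (t + u)))\<^sup>2"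
    by (simp add: c1 power2_eq_square algebra_simps)
  also have "\<dots> = N"
    unfolding s0 st s1 by (simp add: power2_eq_square field_simps)
  finally have "real_of_int (c1\<^sup>2) = N" .
  then have "c1\<^sup>2 = 2 ^ n"
    unfolding N_def assms(1) by (metis of_int_eq_iff of_int_numeral of_int_power of_nat_numeral of_nat_power)
  then have "even n" by (rule even_exponent_if_power2_square)
  then obtain m where n: "n = 2 * m" by (elim evenE)
  have N: "N = 4 ^ m" by (simp add: N_def assms(1) n power_mult)
  have sqrtN: "sqrt N = 2 ^ m"
    by (rule real_sqrt_unique) (simp_all add: N power_even_eq[symmetric] power_mult)
  \<comment> \<open>Parseval's identity for the 4 by 4 Hadamard matrix whose rows give the total and
    \<open>c1\<close>, \<open>c2\<close>, \<open>c3\<close>. It holds for either structure of the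
    group.\<close>
  have "real_of_int (c1\<^sup>2 + c2\<^sup>2 + c3\<^sup>2) =
      4 * real_of_int ((k 0)\<^sup>2 + (k t)\<^sup>2 + (k u)\<^sup>2 + (k (t + u))\<^sup>2)
      - (real_of_int (k 0 + k t + k u + k (t + u)))\<^sup>2"
    by (simp add: c1 c2 c3 power2_eq_square algebra_simps)
  also have "\<dots> = 3 * N"
    unfolding s0 s1 by (simp add: power2_eq_square field_simps)
  also have "\<dots> = real_of_int (3 * 4 ^ m)" by (simp add: N)
  finally have "c1\<^sup>2 + c2\<^sup>2 + c3\<^sup>2 = 3 * 4 ^ m" by (simp only: of_int_eq_iff)
  from sum_three_squares_eq_three_times_power4[OF this]
  have "\<bar>real_of_int c1\<bar> = 2 ^ m" "\<bar>real_of_int c2\<bar> = 2 ^ m" "\<bar>real_of_int c3\<bar> = 2 ^ m"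
    by (metis of_int_abs of_int_numeral of_int_power)+
  then have signs: "real_of_int c1 = sqrt N \<or> real_of_int c1 = - sqrt N"
    "real_of_int c2 = sqrt N \<or> real_of_int c2 = - sqrt N"
    "real_of_int c3 = sqrt N \<or> real_of_int c3 = - sqrt N"
    unfolding sqrtN by linarith+
  \<comment> \<open>Inversion of the same Hadamard matrix.\<close>
  have fibre: "real (card (F -` {0})) = (N + c1 + c2 + c3) / 4"
    "real (card (F -` {t})) = (N + c1 - c2 - c3) / 4"
    "real (card (F -` {u})) = (N - c1 + c2 - c3) / 4"
    "real (card (F -` {t + u})) = (N - c1 - c2 + c3) / 4"
    unfolding s1[symmetric] c1 c2 c3 by (simp_all add: k_def)
  have "\<alpha> = 0 \<or> \<alpha> = t \<or> \<alpha> = u \<or> \<alpha> = t + u" for \<alpha>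
    using UNIV_I[of \<alpha>] unfolding H by simp
  then have exH: "(\<exists>\<alpha>. P \<alpha>) \<longleftrightarrow> P 0 \<or> P t \<or> P u \<or> P (t + u)"
    and allH: "(\<forall>\<alpha>. P \<alpha>) \<longleftrightarrow> P 0 \<and> P t \<and> P u \<and> P (t + u)" for P :: "'h \<Rightarrow> bool"
    by metis+
  have ne: "0 \<noteq> t" "0 \<noteq> u" "0 \<noteq> t + u" "t \<noteq> u" "t \<noteq> t + u" "u \<noteq> t + u"
    "t \<noteq> 0" "u \<noteq> 0" "t + u \<noteq> 0" "u \<noteq> t" "t + u \<noteq> t" "t + u \<noteq> u"
    using d by (auto dest: sym)
  \<comment> \<open>If \<open>c1 * c2 * c3\<close> is negative, one fibre has size
    \<open>(N - 3 * sqrt N) / 4\<close> and the others \<open>(N + sqrt N) / 4\<close>; if it is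
    positive, the signs before \<open>sqrt N\<close> are reversed.\<close>
  show ?thesis
    unfolding exH allH N_def[symmetric] assms(2) fibre
    using signs by (elim disjE) (simp_all only: ne simp_thms of_nat_numeral, argo+)
qed

end
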